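(* Let $p\in(1,\infty)$. Then no sequence of bounded degree graphs is an expander with respect to $(\mathscr{P}_p(\mathbb{R}^3),\mathsf{W}_p)$; that is, for every integer $k\ge 3$, no unbounded sequence of $k$-regular finite graphs is an expander with respect to $(\mathscr{P}_p(\mathbb{R}^3),\mathsf{W}_p)$.
   Context: $\mathbb{R}^3$ carries the Euclidean metric. $\mathscr{P}_p(\mathbb{R}^3)$ is the set of Borel probability measures $\mu$ on $\mathbb{R}^3$ with $\int\|x\|_2^p\,d\mu(x)<\infty$, with the Wasserstein metric $\mathsf{W}_p(\mu,\nu)=\inf_{\pi}\big(\iint\|x-y\|_2^p\,d\pi(x,y)\big)^{1/p}$, the infimum being over couplings $\pi$ of $\mu$ and $\nu$. Expander: fix an integer $k\ge3$. A sequence of $k$-regular finite graphs $\{(V_j,E_j)\}_{j=1}^\infty$ which is unbounded (i.e. $\sup_j|V_j|=\infty$) is an expander with respect to a metric space $(X,d_X)$ if there are constants $0<c\le C<\infty$ (which may depend on $X$ and on the sequence, but not on $j$ or on the points) such that for every $j\in\mathbb{N}$ and every $\{x_u\}_{u\in V_j}\subseteq X$, $$\frac{c}{|E_j|}\sum_{\{u,v\}\in E_j}d_X(x_u,x_v)^2\le\frac1{|V_j|^2}\sum_{(u,v)\in V_j\times V_j}d_X(x_u,x_v)^2\le\frac{C}{|E_j|}\sum_{\{u,v\}\in E_j}d_X(x_u,x_v)^2.$$ *)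

theory Defs
  imports "HOL-Probability.Probability"
begin

definition regular_graph :: "nat \<Rightarrow> 'v set \<Rightarrow> 'v set set \<Rightarrow> bool" where
  "regular_graph k V E \<longleftrightarrow>
     finite V \<and> V \<noteq> {} \<and> (\<forall>e\<in>E. e \<subseteq> V \<and> card e = 2) \<and>
     (\<forall>v\<in>V. card {e \<in> E. v \<in> e} = k)"

(* The squared distance between the images of the two endpoints of an unordered edge.
   The description is well defined as soon as d is symmetric (edge_sq_dist_eq), which
   wasserstein p is (wasserstein_commute). *)
definition edge_sq_dist :: "('a \<Rightarrow> 'a \<Rightarrow> real) \<Rightarrow> ('v \<Rightarrow> 'a) \<Rightarrow> 'v set \<Rightarrow> real" where
  "edge_sq_dist d x e = (THE r. \<exists>u v. e = {u, v} \<and> r = (d (x u) (x v))\<^sup>2)"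

definition expander_wrt ::
  "(nat \<Rightarrow> 'v set) \<Rightarrow> (nat \<Rightarrow> 'v set set) \<Rightarrow> 'a set \<Rightarrow> ('a \<Rightarrow> 'a \<Rightarrow> real) \<Rightarrow> bool" where
  "expander_wrt V E X d \<longleftrightarrow>
     (\<exists>c C :: real. 0 < c \<and> c \<le> C \<and>
       (\<forall>j. \<forall>x. (\<forall>u \<in> V j. x u \<in> X) \<longrightarrow>
          c / real (card (E j)) * (\<Sum>e\<in>E j. edge_sq_dist d x e)
            \<le> 1 / (real (card (V j)))\<^sup>2 * (\<Sum>(u, v)\<in>V j \<times> V j. (d (x u) (x v))\<^sup>2) \<and>
          1 / (real (card (V j)))\<^sup>2 * (\<Sum>(u, v)\<in>V j \<times> V j. (d (x u) (x v))\<^sup>2)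
            \<le> C / real (card (E j)) * (\<Sum>e\<in>E j. edge_sq_dist d x e)))"

definition prob_measures_p :: "real \<Rightarrow> 'a::euclidean_space measure set" where
  "prob_measures_p p =
     {\<mu>. prob_space \<mu> \<and> sets \<mu> = sets borel \<and> integrable \<mu> (\<lambda>x. norm x powr p)}"

definition couplings ::
  "'a::euclidean_space measure \<Rightarrow> 'a measure \<Rightarrow> ('a \<times> 'a) measure set" where
  "couplings \<mu> \<nu> =
     {\<pi>. prob_space \<pi> \<and> sets \<pi> = sets (borel \<Otimes>\<^sub>M borel) \<and>
         distr \<pi> borel fst = \<mu> \<and> distr \<pi> borel snd = \<nu>}"

(* On prob_measures_p p the set of couplings is nonempty and every coupling has finite
   cost (couplings_nonempty, coupling_cost_integrable), so that neither the convention
   that non-integrable functions have integral 0 nor the infimum of the empty set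
   plays a role. *)
definition wasserstein ::
  "real \<Rightarrow> 'a::euclidean_space measure \<Rightarrow> 'a measure \<Rightarrow> real" where
  "wasserstein p \<mu> \<nu> =
     (INF \<pi> \<in> couplings \<mu> \<nu>. (\<integral>(x, y). norm (x - y) powr p \<partial>\<pi>) powr (1 / p))"

lemma edge_sq_dist_eq:
  assumes "\<And>a b. d a b = d b a"
  shows "edge_sq_dist d x {u, v} = (d (x u) (x v))\<^sup>2"
  unfolding edge_sq_dist_def using assms by (intro the_equality) (auto simp: doubleton_eq_iff)

lemma couplings_nonempty:
  assumes "\<mu> \<in> prob_measures_p p" and "\<nu> \<in> prob_measures_p p"
  shows "\<mu> \<Otimes>\<^sub>M \<nu> \<in> couplings \<mu> \<nu>"
proof -
  from assms interpret M: prob_space \<mu> by (simp add: prob_measures_p_def)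
  from assms interpret N: prob_space \<nu> by (simp add: prob_measures_p_def)
  interpret P: pair_prob_space \<mu> \<nu> ..
  have s: "sets \<mu> = sets borel" "sets \<nu> = sets borel"
    using assms by (auto simp: prob_measures_p_def)
  have sp: "space \<mu> = UNIV" "space \<nu> = UNIV"
    using s[THEN sets_eq_imp_space_eq] by auto
  have "distr (\<mu> \<Otimes>\<^sub>M \<nu>) borel fst = distr (\<mu> \<Otimes>\<^sub>M \<nu>) \<mu> fst"
    using s by (intro distr_cong) auto
  also have "\<dots> = \<mu>"
    by (rule N.distr_pair_fst)
  finally have 1: "distr (\<mu> \<Otimes>\<^sub>M \<nu>) borel fst = \<mu>" .
  have 2: "distr (\<mu> \<Otimes>\<^sub>M \<nu>) borel snd = \<nu>"
  proof (rule measure_eqI)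
    show "sets (distr (\<mu> \<Otimes>\<^sub>M \<nu>) borel snd) = sets \<nu>" using s by simp
    fix A assume "A \<in> sets (distr (\<mu> \<Otimes>\<^sub>M \<nu>) borel snd)"
    then have A: "A \<in> sets \<nu>" "A \<in> sets borel" using s by auto
    have m: "snd \<in> (\<mu> \<Otimes>\<^sub>M \<nu>) \<rightarrow>\<^sub>M borel"
      using measurable_snd[of \<mu> \<nu>] s(2) by (simp cong: measurable_cong_sets)
    have "snd -` A \<inter> space (\<mu> \<Otimes>\<^sub>M \<nu>) = space \<mu> \<times> A"
      by (auto simp: space_pair_measure sp)
    then show "emeasure (distr (\<mu> \<Otimes>\<^sub>M \<nu>) borel snd) A = emeasure \<nu> A"
      using A m by (simp add: emeasure_distr N.emeasure_pair_measure_Times M.emeasure_space_1)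
  qed
  have "sets (\<mu> \<Otimes>\<^sub>M \<nu>) = sets (borel \<Otimes>\<^sub>M borel)"
    using s by (intro sets_pair_measure_cong)
  then show ?thesis using 1 2 P.prob_space_axioms by (simp add: couplings_def)
qed

lemma coupling_cost_integrable:
  assumes p: "0 < p" and "\<mu> \<in> prob_measures_p p" and "\<nu> \<in> prob_measures_p p"
    and "\<pi> \<in> couplings \<mu> \<nu>"
  shows "integrable \<pi> (\<lambda>(x, y). norm (x - y) powr p)"
proof -
  have s: "sets \<pi> = sets (borel \<Otimes>\<^sub>M borel)"
    and d: "distr \<pi> borel fst = \<mu>" "distr \<pi> borel snd = \<nu>"
    using assms by (auto simp: couplings_def)
  have m [measurable]: "fst \<in> \<pi> \<rightarrow>\<^sub>M borel" "snd \<in> \<pi> \<rightarrow>\<^sub>M borel"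
    using s by (simp_all cong: measurable_cong_sets)
  have "integrable (distr \<pi> borel fst) (\<lambda>x. norm x powr p)"
    "integrable (distr \<pi> borel snd) (\<lambda>x. norm x powr p)"
    using assms unfolding d by (auto simp: prob_measures_p_def)
  then have i: "integrable \<pi> (\<lambda>z. norm (fst z) powr p)" "integrable \<pi> (\<lambda>z. norm (snd z) powr p)"
    by (simp_all add: integrable_distr_eq)
  have "integrable \<pi> (\<lambda>z. norm (fst z - snd z) powr p)"
  proof (rule Bochner_Integration.integrable_bound)
    show "integrable \<pi> (\<lambda>z. 2 powr p * (norm (fst z) powr p + norm (snd z) powr p))"
      using i by simp
    show "(\<lambda>z. norm (fst z - snd z) powr p) \<in> borel_measurable \<pi>"
      by measurable
    have "norm (x - y) powr p \<le> 2 powr p * (norm x powr p + norm y powr p)" for x y :: 'a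
    proof -
      have "norm (x - y) powr p \<le> (2 * max (norm x) (norm y)) powr p"
        using norm_triangle_ineq4[of x y] p by (intro powr_mono2) auto
      also have "\<dots> = 2 powr p * max (norm x) (norm y) powr p"
        by (rule powr_mult)
      also have "max (norm x) (norm y) powr p \<le> norm x powr p + norm y powr p"
        by (auto simp: max_def)
      finally show ?thesis by simp
    qed
    then show "AE z in \<pi>. norm (norm (fst z - snd z) powr p)
        \<le> norm (2 powr p * (norm (fst z) powr p + norm (snd z) powr p))"
      by simp
  qed
  then show ?thesis by (simp add: case_prod_beta')
qed

lemma wasserstein_commute: "wasserstein p \<mu> \<nu> = wasserstein p \<nu> \<mu>"
proof -
  let ?sw = "\<lambda>(x, y). (y, x)"
  let ?c = "\<lambda>\<pi>. (\<integral>(x, y). norm (x - y :: 'a) powr p \<partial>\<pi>) powr (1 / p)"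
  have *: "?c ` couplings \<mu> \<nu> \<subseteq> ?c ` couplings \<nu> \<mu>" for \<mu> \<nu> :: "'a measure"
  proof
    fix r assume "r \<in> ?c ` couplings \<mu> \<nu>"
    then obtain \<pi> where pi: "\<pi> \<in> couplings \<mu> \<nu>" and r: "r = ?c \<pi>" by blast
    then have s: "sets \<pi> = sets (borel \<Otimes>\<^sub>M borel)" and ps: "prob_space \<pi>"
      and d: "distr \<pi> borel fst = \<mu>" "distr \<pi> borel snd = \<nu>"
      by (auto simp: couplings_def)
    have m [measurable]: "?sw \<in> \<pi> \<rightarrow>\<^sub>M (borel \<Otimes>\<^sub>M borel)"
      using s by (simp cong: measurable_cong_sets)
    let ?q = "distr \<pi> (borel \<Otimes>\<^sub>M borel) ?sw"
    have "distr ?q borel fst = distr \<pi> borel (fst \<circ> ?sw)" by (rule distr_distr) measurable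
    moreover have "distr ?q borel snd = distr \<pi> borel (snd \<circ> ?sw)" by (rule distr_distr) measurable
    moreover have "fst \<circ> ?sw = (snd :: 'a \<times> 'a \<Rightarrow> 'a)" "snd \<circ> ?sw = (fst :: 'a \<times> 'a \<Rightarrow> 'a)"
      by auto
    ultimately have "distr ?q borel fst = distr \<pi> borel snd" "distr ?q borel snd = distr \<pi> borel fst"
      by simp_all
    with d ps have "?q \<in> couplings \<nu> \<mu>"
      by (simp add: couplings_def prob_space.prob_space_distr)
    moreover have "?c ?q = r"
      unfolding r by (subst integral_distr[OF m]) (auto simp: case_prod_beta' norm_minus_commute)
    ultimately show "r \<in> ?c ` couplings \<nu> \<mu>" by blast
  qed
  have "?c ` couplings \<mu> \<nu> = ?c ` couplings \<nu> \<mu>"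
    using * by (intro subset_antisym)
  then show ?thesis unfolding wasserstein_def by (rule arg_cong)
qed

end

theory Submission
  imports Defs
begin

text \<open>
  Truncated at an arbitrary height \<open>n\<close>, the \<open>1/p\<close>-snowflake of every finite graph is visible inside
  the Wasserstein space, up to a constant that depends on \<open>p\<close> alone (\<open>graph_into_wasserstein\<close>):
  there are measures \<open>\<mu> u\<close>, one for each vertex, such that, on a common scale, adjacent vertices
  have distance \<open>O(1)\<close> and any two vertices \<open>u\<close>, \<open>v\<close> have distance at least
  \<open>(min (d(u,v)) n) powr (1/p)\<close>. For such a family the expander inequality says that the average of
  \<open>(min (d(u,v)) n) powr (2/p)\<close> over all pairs of vertices is at most a constant. But a ball of radius
  \<open>n\<close> in a \<open>k\<close>-regular graph contains a bounded number of vertices, so in a large graph at least half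
  of all pairs are at distance at least \<open>n\<close> (\<open>sum_over_far_pairs_ge\<close>), and \<open>n\<close> is arbitrary.

  The measures are built from a drawing of the graph without crossings. Vertices are placed on a line
  in space, edges on a second, skew line, and a vertex is joined to each of its edges by a straight
  strut; struts between two skew lines meet only at common end points. Each strut is divided into
  \<open>m\<close> equal steps. The measure \<open>\<mu> u\<close> is uniform on all division points together with one additional
  atom at the point of \<open>u\<close>. To move the additional atom from \<open>u\<close> to a neighbour \<open>v\<close> it suffices to
  shift every point on the two struts between them by one step, and as \<open>p > 1\<close> these many small steps
  cost only \<open>m powr (1-p)\<close> up to a factor. Hence for large \<open>m\<close> all jumps through empty space are
  prohibitively expensive and mass can only travel along the graph.

  The lower bound is a Kantorovich duality argument, with a potential that imitates the graph
  distance from \<open>v\<close>. The delicate point is that struts with a common end point come arbitrarily close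
  to each other, at an angle that depends on the graph. Therefore the potential is constant on the outer
  thirds of every strut and does all its climbing in the middle third
  (\<open>strut_height_potential\<close>): points on different struts are then either separated by a fixed positive
  distance, or they have the same potential.
\<close>

section \<open>Transport between uniform measures on finite families of points\<close>

definition empirical :: "'i set \<Rightarrow> ('i \<Rightarrow> 'a::euclidean_space) \<Rightarrow> 'a measure" where
  "empirical J g = distr (measure_pmf (pmf_of_set J)) borel g"

lemma empirical_in_prob_measures_p:
  assumes "finite J" "J \<noteq> {}"
  shows "empirical J g \<in> prob_measures_p p"
proof -
  have "integrable (measure_pmf (pmf_of_set J)) (\<lambda>j. norm (g j) powr p)"
    using assms by (intro integrable_measure_pmf_finite) auto
  then show ?thesis
    by (auto simp: prob_measures_p_def empirical_def integrable_distr_eq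
        intro!: prob_space.prob_space_distr prob_space_measure_pmf)
qed

text \<open>
  A permutation of the index set is a transport plan.
\<close>
lemma wasserstein_empirical_le:
  fixes g h :: "'i \<Rightarrow> 'a::euclidean_space"
  assumes J: "finite J" "J \<noteq> {}" and \<sigma>: "bij_betw \<sigma> J J"
  shows "wasserstein p (empirical J g) (empirical J h)
    \<le> ((\<Sum>j\<in>J. norm (g j - h (\<sigma> j)) powr p) / card J) powr (1 / p)"
proof -
  let ?Q = "measure_pmf (pmf_of_set J)"
  define \<pi> where "\<pi> = distr ?Q (borel \<Otimes>\<^sub>M borel) (\<lambda>j. (g j, h (\<sigma> j)))"
  have "distr \<pi> borel fst = distr ?Q borel (fst \<circ> (\<lambda>j. (g j, h (\<sigma> j))))"
    unfolding \<pi>_def by (rule distr_distr) (auto simp: space_pair_measure)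
  then have 1: "distr \<pi> borel fst = empirical J g"
    by (simp add: empirical_def o_def)
  have "distr \<pi> borel snd = distr ?Q borel (snd \<circ> (\<lambda>j. (g j, h (\<sigma> j))))"
    unfolding \<pi>_def by (rule distr_distr) (auto simp: space_pair_measure)
  also have "\<dots> = distr ?Q borel (h \<circ> \<sigma>)"
    by (simp add: o_def)
  also have "\<dots> = distr (distr ?Q (count_space UNIV) \<sigma>) borel h"
    by (rule distr_distr[symmetric]) auto
  also have "distr ?Q (count_space UNIV) \<sigma> = measure_pmf (map_pmf \<sigma> (pmf_of_set J))"
    by (simp add: map_pmf_rep_eq)
  also have "map_pmf \<sigma> (pmf_of_set J) = pmf_of_set J"
    using map_pmf_of_set_bij_betw[OF \<sigma>] J by simp
  finally have 2: "distr \<pi> borel snd = empirical J h"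
    by (simp add: empirical_def)
  have "\<pi> \<in> couplings (empirical J g) (empirical J h)"
    using 1 2 unfolding couplings_def
    by (auto simp: \<pi>_def space_pair_measure intro!: prob_space.prob_space_distr prob_space_measure_pmf)
  moreover have "(\<integral>(x, y). norm (x - y) powr p \<partial>\<pi>)
      = (\<Sum>j\<in>J. norm (g j - h (\<sigma> j)) powr p) / card J"
    unfolding \<pi>_def
    by (subst integral_distr) (auto simp: integral_pmf_of_set J space_pair_measure)
  ultimately show ?thesis
    unfolding wasserstein_def
    by (intro cINF_lower2[of _ _ \<pi>]) (auto intro!: bdd_belowI[of _ 0])
qed

lemma integral_empirical:
  fixes \<phi> :: "'a::euclidean_space \<Rightarrow> real"
  assumes "finite J" "J \<noteq> {}" "\<phi> \<in> borel_measurable borel"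
  shows "(\<integral>a. \<phi> a \<partial>empirical J g) = (\<Sum>j\<in>J. \<phi> (g j)) / card J"
  unfolding empirical_def using assms
  by (subst integral_distr) (auto simp: integral_pmf_of_set)

lemma AE_empirical:
  assumes "finite J" "J \<noteq> {}" 
  shows "AE a in empirical J g. a \<in> g ` J"
  unfolding empirical_def using assms
  by (subst AE_distr_iff) (auto simp: AE_measure_pmf_iff intro!: borel_closed finite_imp_closed)

text \<open>
  The easy half of Kantorovich duality. Only the values of the potential at the finitely many atoms
  matter, because every coupling is concentrated on pairs of atoms; restricting the potential to them
  makes it a bounded simple function, which can be integrated.
\<close>
lemma wasserstein_empirical_ge:
  fixes g h :: "'i \<Rightarrow> 'a::euclidean_space"
  assumes p: "0 < p" and J: "finite J" "J \<noteq> {}"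
    and \<phi>: "\<And>a b. a \<in> g ` J \<Longrightarrow> b \<in> h ` J \<Longrightarrow> \<phi> a - \<phi> b \<le> norm (a - b) powr p"
    and nonneg: "(\<Sum>j\<in>J. \<phi> (h j)) \<le> (\<Sum>j\<in>J. \<phi> (g j))"
  shows "(((\<Sum>j\<in>J. \<phi> (g j)) - (\<Sum>j\<in>J. \<phi> (h j))) / card J) powr (1 / p)
    \<le> wasserstein p (empirical J g) (empirical J h)"
  unfolding wasserstein_def
proof (rule cINF_greatest)
  note prob = empirical_in_prob_measures_p[OF J]
  show "couplings (empirical J g) (empirical J h) \<noteq> {}"
    using couplings_nonempty[OF prob prob] by blast
  fix \<pi> assume \<pi>: "\<pi> \<in> couplings (empirical J g) (empirical J h)"
  then have s: "sets \<pi> = sets (borel \<Otimes>\<^sub>M borel)" and "prob_space \<pi>"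
    and d: "distr \<pi> borel fst = empirical J g" "distr \<pi> borel snd = empirical J h"
    by (auto simp: couplings_def)
  interpret prob_space \<pi> by fact
  have m [measurable]: "fst \<in> \<pi> \<rightarrow>\<^sub>M borel" "snd \<in> \<pi> \<rightarrow>\<^sub>M borel"
    using s by (simp_all cong: measurable_cong_sets)
  define P where "P = g ` J \<union> h ` J"
  define F where "F a = (\<Sum>b\<in>P. \<phi> b * indicator {b} a)" for a
  have P: "finite P" using J by (simp add: P_def)
  have F: "F a = \<phi> a" if "a \<in> P" for a
    using that P by (simp add: F_def indicator_def)
  have [measurable]: "F \<in> borel_measurable borel"
    unfolding F_def by measurable
  have bound: "\<bar>F a\<bar> \<le> (\<Sum>b\<in>P. \<bar>\<phi> b\<bar>)" for a
    unfolding F_def by (rule order_trans[OF sum_abs sum_mono]) (auto simp: indicator_def)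
  have int: "integrable \<pi> (\<lambda>z. F (fst z))" "integrable \<pi> (\<lambda>z. F (snd z))"
    by (intro integrable_const_bound[where B = "\<Sum>b\<in>P. \<bar>\<phi> b\<bar>"] AE_I2; simp add: bound)+
  have "AE a in distr \<pi> borel fst. a \<in> g ` J" "AE a in distr \<pi> borel snd. a \<in> h ` J"
    unfolding d by (rule AE_empirical[OF J])+
  then have AE: "AE z in \<pi>. fst z \<in> g ` J" "AE z in \<pi>. snd z \<in> h ` J"
    using J by (simp_all add: AE_distr_iff[OF m(1)] AE_distr_iff[OF m(2)] borel_closed finite_imp_closed)
  have "(\<integral>z. F (fst z) \<partial>\<pi>) = (\<Sum>j\<in>J. \<phi> (g j)) / card J"
    using integral_distr[OF m(1), of F] d J by (simp add: integral_empirical F P_def)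
  moreover have "(\<integral>z. F (snd z) \<partial>\<pi>) = (\<Sum>j\<in>J. \<phi> (h j)) / card J"
    using integral_distr[OF m(2), of F] d J by (simp add: integral_empirical F P_def)
  ultimately have "((\<Sum>j\<in>J. \<phi> (g j)) - (\<Sum>j\<in>J. \<phi> (h j))) / card J
      = (\<integral>z. F (fst z) - F (snd z) \<partial>\<pi>)"
    using int by (simp add: diff_divide_distrib)
  also have "\<dots> \<le> (\<integral>(x, y). norm (x - y) powr p \<partial>\<pi>)"
  proof (rule integral_mono_AE)
    show "integrable \<pi> (\<lambda>z. F (fst z) - F (snd z))" using int by simp
    show "integrable \<pi> (\<lambda>(x, y). norm (x - y) powr p)"
      by (rule coupling_cost_integrable[OF p prob prob \<pi>])
    show "AE z in \<pi>. F (fst z) - F (snd z) \<le> (case z of (x, y) \<Rightarrow> norm (x - y) powr p)"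
      using AE by eventually_elim (use \<phi> F in \<open>auto simp: P_def\<close>)
  qed
  finally show "(((\<Sum>j\<in>J. \<phi> (g j)) - (\<Sum>j\<in>J. \<phi> (h j))) / card J) powr (1 / p)
      \<le> (\<integral>(x, y). norm (x - y) powr p \<partial>\<pi>) powr (1 / p)"
    using nonneg p by (intro powr_mono2) auto
qed

section \<open>Struts between two skew lines\<close>

text \<open>
  The point at height \<open>t\<close> on the segment from \<open>(x u, 0, 0)\<close> to \<open>(0, y e, 1)\<close>. The third coordinate of a
  point is its parameter, so that two points at different parameters are apart no matter which struts
  they lie on.
\<close>
definition strut :: "('v \<Rightarrow> real) \<Rightarrow> ('e \<Rightarrow> real) \<Rightarrow> 'v \<Rightarrow> 'e \<Rightarrow> real \<Rightarrow> real ^ 3" where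
  "strut x y u e t = vector [(1 - t) * x u, t * y e, t]"

lemma strut_0: "strut x y u e 0 = strut x y u e' 0"
  and strut_1: "strut x y u e 1 = strut x y u' e 1"
  by (simp_all add: strut_def)

lemma strut_diff_coords:
  "\<bar>(1 - s) * x u - (1 - t) * x u'\<bar> \<le> norm (strut x y u e s - strut x y u' e' t)"
  "\<bar>s * y e - t * y e'\<bar> \<le> norm (strut x y u e s - strut x y u' e' t)"
  "\<bar>s - t\<bar> \<le> norm (strut x y u e s - strut x y u' e' t)"
  using component_le_norm_cart[of "strut x y u e s - strut x y u' e' t"]
  by (auto simp: strut_def dest: spec[of _ 1] intro: order_trans) 
     (metis vector_3 vector_minus_component)+

lemma strut_lipschitz:
  assumes "\<bar>x u\<bar> \<le> 1" "\<bar>y e\<bar> \<le> 1"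
  shows "norm (strut x y u e s - strut x y u e t) \<le> 3 * \<bar>s - t\<bar>"
proof -
  have "norm (strut x y u e s - strut x y u e t)
      \<le> \<bar>(t - s) * x u\<bar> + \<bar>(s - t) * y e\<bar> + \<bar>s - t\<bar>"
    using norm_le_l1_cart[of "strut x y u e s - strut x y u e t"]
    by (simp add: strut_def sum_3 algebra_simps)
  also have "\<dots> \<le> \<bar>t - s\<bar> * 1 + \<bar>s - t\<bar> * 1 + \<bar>s - t\<bar>"
    using assms unfolding abs_mult by (intro add_mono mult_left_mono) auto
  finally show ?thesis by (simp add: abs_minus_commute)
qed

text \<open>
  Struts that lead to different points of the upper line diverge linearly in the height. The two
  points need not have the same height, but a difference in height is itself at most their distance,
  which explains the factor 2. The next lemma is the same statement for the lower line.
\<close>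
lemma strut_apart_at_top:
  assumes "\<bar>y e'\<bar> \<le> 1" "\<eta> \<le> \<bar>y e - y e'\<bar>" "0 \<le> s"
  shows "s * \<eta> \<le> 2 * norm (strut x y u e s - strut x y u' e' t)"
proof -
  have "s * \<eta> \<le> s * \<bar>y e - y e'\<bar>"
    using assms by (intro mult_left_mono)
  also have "\<dots> = \<bar>s * (y e - y e')\<bar>"
    using assms by (simp add: abs_mult)
  also have "s * (y e - y e') = (s * y e - t * y e') - (s - t) * y e'"
    by (simp add: algebra_simps)
  also have "\<bar>\<dots>\<bar> \<le> \<bar>s * y e - t * y e'\<bar> + \<bar>s - t\<bar> * \<bar>y e'\<bar>"
    by (metis abs_mult abs_triangle_ineq4)
  also have "\<bar>s - t\<bar> * \<bar>y e'\<bar> \<le> \<bar>s - t\<bar>"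
    using assms mult_left_mono[of "\<bar>y e'\<bar>" 1 "\<bar>s - t\<bar>"] by simp
  finally show ?thesis
    using strut_diff_coords(2)[of s y e t e' x u u'] strut_diff_coords(3)[of s t x y u e u' e'] 
    by linarith
qed

lemma strut_apart_at_bottom:
  assumes "\<bar>x u'\<bar> \<le> 1" "\<eta> \<le> \<bar>x u - x u'\<bar>" "s \<le> 1"
  shows "(1 - s) * \<eta> \<le> 2 * norm (strut x y u e s - strut x y u' e' t)"
proof -
  have "(1 - s) * \<eta> \<le> (1 - s) * \<bar>x u - x u'\<bar>"
    using assms by (intro mult_left_mono) auto
  also have "\<dots> = \<bar>(1 - s) * (x u - x u')\<bar>"
    using assms by (simp add: abs_mult)
  also have "(1 - s) * (x u - x u') = ((1 - s) * x u - (1 - t) * x u') - (t - s) * x u'"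
    by (simp add: algebra_simps)
  also have "\<bar>\<dots>\<bar> \<le> \<bar>(1 - s) * x u - (1 - t) * x u'\<bar> + \<bar>t - s\<bar> * \<bar>x u'\<bar>"
    by (metis abs_mult abs_triangle_ineq4)
  also have "\<bar>t - s\<bar> * \<bar>x u'\<bar> \<le> \<bar>s - t\<bar>"
    using assms mult_left_mono[of "\<bar>x u'\<bar>" 1 "\<bar>t - s\<bar>"] by simp
  finally show ?thesis
    using strut_diff_coords(1)[of s x u t u' y e e'] strut_diff_coords(3)[of s t x y u e u' e'] 
    by linarith
qed

definition ramp :: "real \<Rightarrow> real" where
  "ramp t = max 0 (min 1 (3 * t - 1))"

lemma ramp_bounds: "0 \<le> ramp t" "ramp t \<le> 1" "\<bar>ramp s - ramp t\<bar> \<le> 3 * \<bar>s - t\<bar>"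
  unfolding ramp_def by (auto simp: max_def min_def abs_if)

text \<open>
  A function on the struts with prescribed values at their end points, constant on the outer thirds.
\<close>
definition strut_height :: "('v \<Rightarrow> real) \<Rightarrow> ('e \<Rightarrow> real) \<Rightarrow> 'v \<Rightarrow> 'e \<Rightarrow> real \<Rightarrow> real" where
  "strut_height D h u e t = D u + (h e - D u) * ramp t"

lemma strut_height_bounds:
  assumes "0 \<le> D u" "D u \<le> H" "0 \<le> h e" "h e \<le> H"
  shows "0 \<le> strut_height D h u e t" "strut_height D h u e t \<le> H"
proof -
  have *: "strut_height D h u e t = (1 - ramp t) * D u + ramp t * h e"
    by (simp add: strut_height_def algebra_simps)
  show "0 \<le> strut_height D h u e t"
    unfolding * using assms ramp_bounds(1,2)[of t] by simp
  show "strut_height D h u e t \<le> H"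
    unfolding * using assms ramp_bounds(1,2)[of t] by (intro convex_bound_le) auto
qed

text \<open>
  If the struts end at different points of the upper line, two close points must lie in the lower
  third, and if they start at different points of the lower line, they must lie in the upper third.
  Both cannot happen, so the struts share an end point, and both points lie in the third next to it,
  where the height has the value prescribed at that end point.
\<close>
lemma strut_height_eq_if_close:
  assumes "\<And>v. v \<in> V \<Longrightarrow> \<bar>x v\<bar> \<le> 1" "\<And>v w. v \<in> V \<Longrightarrow> w \<in> V \<Longrightarrow> v \<noteq> w \<Longrightarrow> \<eta> \<le> \<bar>x v - x w\<bar>"
    and "\<And>e. e \<in> E \<Longrightarrow> \<bar>y e\<bar> \<le> 1" "\<And>e f. e \<in> E \<Longrightarrow> f \<in> E \<Longrightarrow> e \<noteq> f \<Longrightarrow> \<eta> \<le> \<bar>y e - y f\<bar>"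
    and "u \<in> V" "u' \<in> V" "e \<in> E" "e' \<in> E" "(u, e) \<noteq> (u', e')"
    and st: "0 \<le> s" "s \<le> 1" "0 \<le> t" "t \<le> 1" and \<eta>: "0 < \<eta>"
    and close: "norm (strut x y u e s - strut x y u' e' t) < \<eta> / 6" (is "?n < _")
  shows "strut_height D h u e s = strut_height D h u' e' t"
proof -
  have top: "s < 1/3 \<and> t < 1/3" if "e \<noteq> e'"
  proof -
    have "s * \<eta> \<le> 2 * ?n" "t * \<eta> \<le> 2 * ?n"
      using strut_apart_at_top[of y e' \<eta> e s x u u' t] strut_apart_at_top[of y e \<eta> e' t x u' u s]
        that assms by (auto simp: norm_minus_commute)
    then have "s * \<eta> < 1/3 * \<eta>" "t * \<eta> < 1/3 * \<eta>" using close by linarith+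
    then show ?thesis using \<eta> mult_less_cancel_right_pos by blast
  qed
  have bot: "1 - s < 1/3 \<and> 1 - t < 1/3" if "u \<noteq> u'"
  proof -
    have "(1 - s) * \<eta> \<le> 2 * ?n" "(1 - t) * \<eta> \<le> 2 * ?n"
      using strut_apart_at_bottom[of x u' \<eta> u s y e e' t] strut_apart_at_bottom[of x u \<eta> u' t y e' e s]
        that assms by (auto simp: norm_minus_commute)
    then have "(1 - s) * \<eta> < 1/3 * \<eta>" "(1 - t) * \<eta> < 1/3 * \<eta>" using close by linarith+
    then show ?thesis using \<eta> mult_less_cancel_right_pos by blast
  qed
  show ?thesis
  proof (cases "e = e'")
    case True
    with bot assms have "ramp s = 1" "ramp t = 1" by (auto simp: ramp_def)
    with True show ?thesis by (simp add: strut_height_def)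
  next
    case False
    with top have "ramp s = 0" "ramp t = 0" by (auto simp: ramp_def)
    moreover have "u = u'" using False top bot by fastforce
    ultimately show ?thesis by (simp add: strut_height_def)
  qed
qed

text \<open>
  The potential satisfies the dual constraint. On one strut, climbing over \<open>d\<close> steps gains at most
  \<open>m powr (1-p) * d / m\<close>, which is at most \<open>(d / m) powr p\<close> because \<open>d\<close> is a natural number and \<open>p > 1\<close>.
  Between different struts only distances of at least \<open>\<eta> / 6\<close> matter, and there the whole range of the
  potential is cheap once \<open>m\<close> is large.
\<close>
lemma strut_height_potential:
  fixes m i j :: nat and p :: real
  assumes x: "\<And>v. v \<in> V \<Longrightarrow> \<bar>x v\<bar> \<le> 1" "\<And>v w. v \<in> V \<Longrightarrow> w \<in> V \<Longrightarrow> v \<noteq> w \<Longrightarrow> \<eta> \<le> \<bar>x v - x w\<bar>"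
    and y: "\<And>e. e \<in> E \<Longrightarrow> \<bar>y e\<bar> \<le> 1" "\<And>e f. e \<in> E \<Longrightarrow> f \<in> E \<Longrightarrow> e \<noteq> f \<Longrightarrow> \<eta> \<le> \<bar>y e - y f\<bar>"
    and mem: "u \<in> V" "u' \<in> V" "e \<in> E" "e' \<in> E"
    and D: "\<And>v. v \<in> V \<Longrightarrow> 0 \<le> D v \<and> D v \<le> H" and h: "\<And>e. e \<in> E \<Longrightarrow> 0 \<le> h e \<and> h e \<le> H"
    and step: "\<bar>h e - D u\<bar> \<le> 1"
    and p: "1 < p" and \<eta>: "0 < \<eta>" and ij: "i \<le> m" "j \<le> m" and m: "0 < m"
    and mH: "real m powr (1 - p) / 3 * H \<le> (\<eta> / 6) powr p"
  shows "real m powr (1 - p) / 3 * strut_height D h u e (i / m)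
      - real m powr (1 - p) / 3 * strut_height D h u' e' (j / m)
    \<le> norm (strut x y u e (i / m) - strut x y u' e' (j / m)) powr p"
    (is "?\<tau> * ?a - ?\<tau> * ?b \<le> ?n powr p")
proof -
  have unit: "0 \<le> real i / m" "real i / m \<le> 1" "0 \<le> real j / m" "real j / m \<le> 1"
    using ij m by auto
  consider "(u, e) = (u', e')" | "(u, e) \<noteq> (u', e')" "?n < \<eta> / 6" | "\<eta> / 6 \<le> ?n" by linarith
  then show ?thesis
  proof cases
    case 1
    define d where "d = \<bar>real i - real j\<bar>"
    have d: "\<bar>real i / m - real j / m\<bar> = d / m"
      using m by (simp add: d_def flip: diff_divide_distrib)
    have "?a - ?b = (h e - D u) * (ramp (i / m) - ramp (j / m))"
      using 1 by (simp add: strut_height_def algebra_simps)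
    also have "\<dots> \<le> \<bar>h e - D u\<bar> * \<bar>ramp (i / m) - ramp (j / m)\<bar>"
      by (metis abs_ge_self abs_mult)
    also have "\<dots> \<le> 1 * (3 * (d / m))"
      using step ramp_bounds(3)[of "i / m" "j / m"] d by (intro mult_mono) auto
    finally have "?\<tau> * (?a - ?b) \<le> ?\<tau> * (3 * (d / m))"
      by (intro mult_left_mono) auto
    also have "\<dots> = d * real m powr (- p)"
      using m powr_add[of "real m" "- p" 1] by (simp add: field_simps)
    also have "\<dots> \<le> d powr p * real m powr (- p)"
    proof (rule mult_right_mono)
      have "d = 0 \<or> 1 \<le> d" unfolding d_def by (cases i j rule: linorder_cases) auto
      then show "d \<le> d powr p"
        using p powr_mono[of 1 p d] by (auto simp: d_def)
    qed simp
    also have "\<dots> = (d / m) powr p"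
      using m by (simp add: powr_divide d_def powr_minus field_simps)
    also have "\<dots> \<le> ?n powr p"
      using strut_diff_coords(3)[of "i / m" "j / m" x y u e u' e'] p
      by (intro powr_mono2) (auto simp: d d_def)
    finally show ?thesis by (simp add: algebra_simps)
  next
    case 2
    then have "?a = ?b"
      using strut_height_eq_if_close[OF x y mem 2(1) unit \<eta> 2(2)] by blast
    then show ?thesis by simp
  next
    case 3
    have "?a \<le> H" "0 \<le> ?b"
      using strut_height_bounds[of D u H h e] strut_height_bounds[of D u' H h e'] D h mem by auto
    then have "?\<tau> * (?a - ?b) \<le> ?\<tau> * H"
      by (intro mult_left_mono) auto
    also have "\<dots> \<le> (\<eta> / 6) powr p" by (rule mH)
    also have "\<dots> \<le> ?n powr p"
      using 3 p \<eta> by (intro powr_mono2) auto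
    finally show ?thesis by (simp add: algebra_simps)
  qed
qed

section \<open>Realising a graph by measures\<close>

lemma separated_labelling:
  assumes "finite S"
  obtains f :: "'a \<Rightarrow> real" and \<eta> where "0 < \<eta>" "\<And>a. a \<in> S \<Longrightarrow> \<bar>f a\<bar> \<le> 1"
    "\<And>a b. a \<in> S \<Longrightarrow> b \<in> S \<Longrightarrow> a \<noteq> b \<Longrightarrow> \<eta> \<le> \<bar>f a - f b\<bar>"
proof -
  obtain g where g: "bij_betw g S {0..<card S}"
    using ex_bij_betw_finite_nat[OF assms] by blast
  show ?thesis
  proof
    show "0 < 1 / real (Suc (card S))" by simp
    show "\<bar>real (g a) / real (Suc (card S))\<bar> \<le> 1" if "a \<in> S" for a
      using bij_betwE[OF g] that by (auto simp: le_Suc_eq)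
    show "1 / real (Suc (card S)) \<le> \<bar>real (g a) / real (Suc (card S)) - real (g b) / real (Suc (card S))\<bar>"
      if "a \<in> S" "b \<in> S" "a \<noteq> b" for a b
    proof -
      have "g a \<noteq> g b" using g that by (auto simp: bij_betw_def inj_on_def)
      then have "1 \<le> \<bar>real (g a) - real (g b)\<bar>" by linarith
      then show ?thesis
        unfolding diff_divide_distrib[symmetric] abs_divide by (simp add: divide_right_mono)
    qed
  qed
qed

text \<open>
  One step along the path from \<open>a\<close> up to the edge \<open>e\<close> and down again to \<open>b\<close>. The index \<open>None\<close>
  stands for the additional atom, which starts at \<open>a\<close> and ends at \<open>b\<close>; all other struts stay in place.
  The two struts share their top point, which is counted once for each of them, so that the step from
  one strut to the other is free, just as the first and the last step are.
\<close>
definition strut_shift :: "'v \<Rightarrow> 'v \<Rightarrow> 'e \<Rightarrow> nat \<Rightarrow> ('v \<times> 'e \<times> nat) option \<Rightarrow> ('v \<times> 'e \<times> nat) option" where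
  "strut_shift a b e m j = (case j of
      None \<Rightarrow> Some (a, e, 0)
    | Some (w, f, i) \<Rightarrow>
        if f = e \<and> w = a then (if i < m then Some (a, e, Suc i) else Some (b, e, m))
        else if f = e \<and> w = b then (case i of 0 \<Rightarrow> None | Suc i' \<Rightarrow> Some (b, e, i'))
        else j)"

lemma bij_betw_strut_shift:
  assumes J: "J = insert None (Some ` {(w, f, i). w \<in> f \<and> f \<in> E \<and> i \<le> m})" "finite J"
    and e: "e \<in> E" "a \<in> e" "b \<in> e" "a \<noteq> b"
  shows "bij_betw (strut_shift a b e m) J J"
proof -
  have "strut_shift a b e m ` J \<subseteq> J"
    using e by (auto simp: J strut_shift_def split: option.splits nat.splits if_splits)
  moreover have "inj_on (strut_shift a b e m) J"
    using e unfolding inj_on_def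
    by (auto simp: J strut_shift_def split: option.splits nat.splits if_splits)
  ultimately show ?thesis
    using J(2) by (simp add: bij_betw_def endo_inj_surj)
qed


definition edge_lipschitz :: "'v set set \<Rightarrow> ('v \<Rightarrow> real) \<Rightarrow> bool" where
  "edge_lipschitz E D \<longleftrightarrow> (\<forall>a b. {a, b} \<in> E \<longrightarrow> \<bar>D a - D b\<bar> \<le> 1)"

text \<open>
  The snowflake embedding. The lower bound is stated for an arbitrary Lipschitz function on the
  vertices instead of the graph distance, since this is the form in which the potential uses it. The bound
  \<open>H\<close> on its range decides how fine the subdivision must be; without a bound no single \<open>m\<close> would do
  for a disconnected graph.
\<close>
lemma graph_into_wasserstein:
  fixes V :: "'v set" and E :: "'v set set" and H p :: real
  assumes p: "1 < p" and V: "finite V" and edges: "\<forall>e\<in>E. e \<subseteq> V \<and> card e = 2"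
    and covered: "\<forall>u\<in>V. \<exists>e\<in>E. u \<in> e"
  obtains s :: real and \<mu> :: "'v \<Rightarrow> (real ^ 3) measure" where
    "0 < s" "\<And>u. \<mu> u \<in> prob_measures_p p"
    "\<And>a b. {a, b} \<in> E \<Longrightarrow> wasserstein p (\<mu> a) (\<mu> b) \<le> (6 * 3 powr p * s) powr (1 / p)"
    "\<forall>D. D ` V \<subseteq> {0..H} \<longrightarrow> edge_lipschitz E D \<longrightarrow> (\<forall>u\<in>V. \<forall>v\<in>V. D v \<le> D u \<longrightarrow>
      (s * (D u - D v)) powr (1 / p) \<le> wasserstein p (\<mu> u) (\<mu> v))"
proof -
  note E = edges[rule_format]
  have finE: "finite E" using E V by (intro finite_subset[of E "Pow V"]) auto
  obtain x :: "'v \<Rightarrow> real" and \<eta>1 where x: "0 < \<eta>1" "\<And>a. a \<in> V \<Longrightarrow> \<bar>x a\<bar> \<le> 1"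
    "\<And>a b. a \<in> V \<Longrightarrow> b \<in> V \<Longrightarrow> a \<noteq> b \<Longrightarrow> \<eta>1 \<le> \<bar>x a - x b\<bar>"
    by (rule separated_labelling[OF V]) blast
  obtain y :: "'v set \<Rightarrow> real" and \<eta>2 where y: "0 < \<eta>2" "\<And>a. a \<in> E \<Longrightarrow> \<bar>y a\<bar> \<le> 1"
    "\<And>a b. a \<in> E \<Longrightarrow> b \<in> E \<Longrightarrow> a \<noteq> b \<Longrightarrow> \<eta>2 \<le> \<bar>y a - y b\<bar>"
    by (rule separated_labelling[OF finE]) blast
  define \<eta> where "\<eta> = min \<eta>1 \<eta>2"
  have \<eta>: "0 < \<eta>" using x y by (simp add: \<eta>_def)
  have x': "\<eta> \<le> \<bar>x a - x b\<bar>" if "a \<in> V" "b \<in> V" "a \<noteq> b" for a b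
    using x(3)[OF that] by (simp add: \<eta>_def)
  have y': "\<eta> \<le> \<bar>y a - y b\<bar>" if "a \<in> E" "b \<in> E" "a \<noteq> b" for a b
    using y(3)[OF that] by (simp add: \<eta>_def)
  \<comment> \<open>The place where \<open>p > 1\<close> is essential: fine subdivision makes transport along struts cheap.\<close>
  have "(\<lambda>m. real m powr (1 - p) / 3 * H) \<longlonglongrightarrow> 0 / 3 * H"
    using p by (intro tendsto_intros tendsto_neg_powr filterlim_real_sequentially) auto
  then have "\<forall>\<^sub>F m in sequentially. real m powr (1 - p) / 3 * H < (\<eta> / 6) powr p"
    by (rule order_tendstoD) (use \<eta> in simp)
  then have "\<forall>\<^sub>F m in sequentially. real m powr (1 - p) / 3 * H < (\<eta> / 6) powr p \<and> 0 < m"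
    using eventually_gt_at_top by (rule eventually_conj)
  then obtain m where m: "real m powr (1 - p) / 3 * H \<le> (\<eta> / 6) powr p" "0 < m"
    by (auto simp: eventually_sequentially intro: less_imp_le)
  define I where "I = {(w, f, i). w \<in> f \<and> f \<in> E \<and> i \<le> m}"
  define J where "J = insert None (Some ` I)"
  have "I \<subseteq> V \<times> E \<times> {..m}" using E by (auto simp: I_def)
  then have J: "finite J" "J \<noteq> {}"
    using V finE finite_subset[of I] by (auto simp: J_def)
  define pt where "pt = (\<lambda>(w, f, i::nat). strut x y w f (i / m))"
  define g where "g u j = (case j of None \<Rightarrow> strut x y u {} 0 | Some k \<Rightarrow> pt k)" for u j
  have base: "strut x y u {} 0 = pt (u, e, 0)" for u e
    by (simp add: pt_def strut_0[of x y u "{}" e])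
  \<comment> \<open>One unit of graph distance costs about \<open>m powr (1 - p)\<close>, and each atom has mass \<open>1 / card J\<close>.\<close>
  define s where "s = real m powr (1 - p) / (3 * card J)"
  have cJ: "0 < card J" using J by (simp add: card_gt_0_iff)
  show ?thesis
  proof
    show "0 < s" using m cJ by (simp add: s_def)
    show "empirical J (g u) \<in> prob_measures_p p" for u
      by (rule empirical_in_prob_measures_p[OF J])
  next
    fix a b assume e: "{a, b} \<in> E"
    define e where "e = {a, b}"
    have ab: "a \<noteq> b" "a \<in> e" "b \<in> e" "e \<in> E" using E[of e] e by (auto simp: e_def)
    have V: "a \<in> V" "b \<in> V" using E[of e] ab by auto
    let ?\<sigma> = "strut_shift a b e m"
    \<comment> \<open>The indices whose atom moves a positive distance.\<close>
    define S where "S = (\<lambda>i. Some (a, e, i)) ` {..<m} \<union> (\<lambda>i. Some (b, e, i)) ` {1..m}"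
    have \<sigma>: "bij_betw ?\<sigma> J J"
      using ab J by (intro bij_betw_strut_shift) (auto simp: J_def I_def)
    have "card S \<le> card {..<m} + card {1..m}"
      unfolding S_def by (intro order_trans[OF card_Un_le] add_mono card_image_le) auto
    then have S: "finite S" "card S \<le> 2 * m" by (auto simp: S_def)
    have step: "norm (pt (w, e, i) - pt (w, e, Suc i)) \<le> 3 / m" if "w \<in> V" for w i
    proof -
      have "\<bar>real i / m - real (Suc i) / m\<bar> = 1 / m"
        by (simp flip: diff_divide_distrib)
      then show ?thesis
        using strut_lipschitz[of x w y e "i / m" "Suc i / m"] x(2)[OF that] y(2)[OF ab(4)]
        by (simp add: pt_def)
    qed
    have cost: "norm (g a j - g b (?\<sigma> j)) powr p \<le> (if j \<in> S then (3 / m) powr p else 0)"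
      if "j \<in> J" for j
    proof (cases j)
      case None
      then show ?thesis by (auto simp: g_def strut_shift_def base[of _ e] S_def)
    next
      case (Some k)
      obtain w f i where k: "k = (w, f, i)" by (cases k)
      have i: "i \<le> m" using that Some k by (auto simp: J_def I_def)
      consider "f = e" "w = a" "i < m" | "f = e" "w = a" "i = m" | "f = e" "w = b" "i = 0"
        | i' where "f = e" "w = b" "i = Suc i'" | "\<not> (f = e \<and> w = a)" "\<not> (f = e \<and> w = b)"
        using i by (cases i) (auto simp: le_less)
      then show ?thesis
      proof cases
        case 1
        then have "?\<sigma> j = Some (a, e, Suc i)" "j \<in> S" by (auto simp: Some k strut_shift_def S_def)
        then show ?thesis using 1 p step[OF V(1), of i]
          by (auto simp: Some k g_def intro!: powr_mono2)
      next
        case 2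
        then have "?\<sigma> j = Some (b, e, m)" using ab by (auto simp: Some k strut_shift_def)
        then show ?thesis using 2 m strut_1[of x y a e b] by (auto simp: Some k g_def pt_def)
      next
        case 3
        then have "?\<sigma> j = None" using ab by (auto simp: Some k strut_shift_def)
        then show ?thesis using 3 by (auto simp: Some k g_def base[of _ e])
      next
        case 4
        then have "?\<sigma> j = Some (b, e, i')" "j \<in> S" using ab i
          by (auto simp: Some k strut_shift_def S_def)
        then show ?thesis using 4 p step[OF V(2), of i']
          by (auto simp: Some k g_def norm_minus_commute intro!: powr_mono2)
      next
        case 5
        then have "?\<sigma> j = j" by (auto simp: Some k strut_shift_def)
        then show ?thesis by (simp add: Some g_def)
      qed
    qed
    have "(\<Sum>j\<in>J. norm (g a j - g b (?\<sigma> j)) powr p) \<le> (\<Sum>j\<in>J. if j \<in> S then (3 / m) powr p else 0)"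
      by (rule sum_mono) (rule cost)
    also have "\<dots> = card (J \<inter> S) * (3 / m) powr p"
      using J by (simp add: sum.If_cases)
    also have "\<dots> \<le> (2 * m) * (3 / m) powr p"
      using S card_mono[of S "J \<inter> S"] by (intro mult_right_mono) auto
    also have "\<dots> = 6 * 3 powr p * s * card J"
      using m cJ by (simp add: s_def powr_divide powr_diff)
    finally have "(\<Sum>j\<in>J. norm (g a j - g b (?\<sigma> j)) powr p) / card J \<le> 6 * 3 powr p * s"
      using cJ by (simp add: field_simps)
    then show "wasserstein p (empirical J (g a)) (empirical J (g b)) \<le> (6 * 3 powr p * s) powr (1 / p)"
      using wasserstein_empirical_le[OF J \<sigma>, of p "g a" "g b"] p
      by (elim order_trans) (auto intro!: powr_mono2 sum_nonneg divide_nonneg_nonneg)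
  next
    show "\<forall>D. D ` V \<subseteq> {0..H} \<longrightarrow> edge_lipschitz E D \<longrightarrow> (\<forall>u\<in>V. \<forall>v\<in>V. D v \<le> D u \<longrightarrow>
        (s * (D u - D v)) powr (1 / p) \<le> wasserstein p (empirical J (g u)) (empirical J (g v)))"
    proof (intro allI impI ballI)
      fix D u v
      assume range: "D ` V \<subseteq> {0..H}" and lip: "edge_lipschitz E D"
        and uv: "u \<in> V" "v \<in> V" "D v \<le> D u"
      have D: "0 \<le> D a \<and> D a \<le> H" if "a \<in> V" for a
        using range that by auto
      \<comment> \<open>The value on an edge point only has to differ by at most 1 from those at both end points.\<close>
      define h where "h e = Min (D ` e)" for e
      have h: "h e \<in> D ` e" if "e \<in> E" for e
        using E[OF that] V finite_subset[of e V] unfolding h_def by (intro Min_in) auto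
      have hH: "0 \<le> h e \<and> h e \<le> H" if "e \<in> E" for e
      proof -
        obtain c where "c \<in> e" "h e = D c" using h[OF \<open>e \<in> E\<close>] by auto
        then show ?thesis using D[of c] E[OF \<open>e \<in> E\<close>] by auto
      qed
      have hD: "\<bar>h e - D w\<bar> \<le> 1" if "e \<in> E" "w \<in> e" for e w
      proof -
        obtain c where "c \<in> e" "h e = D c" using h[OF \<open>e \<in> E\<close>] by auto
        moreover have "{c, w} \<in> E" if "c \<noteq> w"
        proof -
          obtain a b where "e = {a, b}" using E[OF \<open>e \<in> E\<close>] by (auto simp: card_2_iff)
          then have "e = {c, w}" using \<open>c \<in> e\<close> \<open>w \<in> e\<close> that by blast
          then show ?thesis using \<open>e \<in> E\<close> by simp
        qed
        ultimately show ?thesis using lip unfolding edge_lipschitz_def by (cases "c = w") auto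
      qed
      define \<tau> where "\<tau> = real m powr (1 - p) / 3"
      define \<psi> where "\<psi> = (\<lambda>(w, f, i::nat). \<tau> * strut_height D h w f (i / m))"
      have pot: "\<psi> k - \<psi> l \<le> norm (pt k - pt l) powr p" if kl: "k \<in> I" "l \<in> I" for k l
      proof -
        obtain w f i w' f' i' where kl_eq: "k = (w, f, i)" "l = (w', f', i')"
          using prod_cases3 by metis
        have "w \<in> V" "w' \<in> V" "w \<in> f" "f \<in> E" "f' \<in> E" "i \<le> m" "i' \<le> m"
          using kl E by (auto simp: kl_eq I_def)
        then show ?thesis
          unfolding \<psi>_def pt_def kl_eq prod.case \<tau>_def
          by (intro strut_height_potential[OF x(2) x' y(2) y', where H = H] D hH hD p \<eta> m)
      qed
      \<comment> \<open>Division points may coincide, but \<open>pot\<close> forces equal potentials on equal points, so that any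
          choice of an index defines the potential as a function on space.\<close>
      define \<phi> where "\<phi> q = \<psi> (inv_into I pt q)" for q
      have \<phi>: "\<phi> (pt k) = \<psi> k" if "k \<in> I" for k
      proof -
        have "inv_into I pt (pt k) \<in> I" "pt (inv_into I pt (pt k)) = pt k"
          using that by (auto intro: inv_into_into f_inv_into_f)
        then show ?thesis
          using pot[of "inv_into I pt (pt k)" k] pot[of k "inv_into I pt (pt k)"] that
          by (simp add: \<phi>_def)
      qed
      have vertex: "\<exists>k\<in>I. g w None = pt k \<and> \<psi> k = \<tau> * D w" if "w \<in> V" for w
      proof -
        obtain e where "e \<in> E" "w \<in> e" using covered \<open>w \<in> V\<close> by blast
        then show ?thesis
          by (intro bexI[of _ "(w, e, 0)"])
            (auto simp: g_def base[of _ e] \<psi>_def strut_height_def ramp_def I_def)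
      qed
      have img: "g w ` J \<subseteq> pt ` I" if "w \<in> V" for w
        using vertex[OF that] by (auto simp: J_def g_def)
      have val: "\<phi> (g w None) = \<tau> * D w" if "w \<in> V" for w
        using vertex[OF that] \<phi> by auto
      have sum: "(\<Sum>j\<in>J. \<phi> (g w j)) = \<phi> (g w None) + (\<Sum>k\<in>I. \<phi> (pt k))" for w
        using J(1) by (simp add: J_def sum.reindex g_def finite_image_iff)
      have diff: "(\<Sum>j\<in>J. \<phi> (g u j)) - (\<Sum>j\<in>J. \<phi> (g v j)) = \<tau> * (D u - D v)"
        unfolding sum val[OF uv(1)] val[OF uv(2)] by (simp add: algebra_simps)
      moreover have "0 \<le> \<tau>" by (simp add: \<tau>_def)
      ultimately have "(((\<Sum>j\<in>J. \<phi> (g u j)) - (\<Sum>j\<in>J. \<phi> (g v j))) / card J) powr (1 / p)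
          \<le> wasserstein p (empirical J (g u)) (empirical J (g v))"
      proof (intro wasserstein_empirical_ge J)
        show "\<phi> a - \<phi> b \<le> norm (a - b) powr p" if ab: "a \<in> g u ` J" "b \<in> g v ` J" for a b
        proof -
          obtain k l where "k \<in> I" "l \<in> I" "a = pt k" "b = pt l"
            using ab img[OF uv(1)] img[OF uv(2)] by blast
          then show ?thesis using pot[of k l] by (simp add: \<phi>)
        qed
        show "(\<Sum>j\<in>J. \<phi> (g v j)) \<le> (\<Sum>j\<in>J. \<phi> (g u j))"
          using diff mult_nonneg_nonneg[OF \<open>0 \<le> \<tau>\<close>, of "D u - D v"] uv(3) by linarith
      qed (use p in auto)
      then show "(s * (D u - D v)) powr (1 / p) \<le> wasserstein p (empirical J (g u)) (empirical J (g v))"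
        unfolding diff by (simp add: s_def \<tau>_def)
    qed
  qed
qed

section \<open>Balls in bounded degree graphs\<close>

fun graph_ball :: "'v set set \<Rightarrow> 'v \<Rightarrow> nat \<Rightarrow> 'v set" where
  "graph_ball E v 0 = {v}"
| "graph_ball E v (Suc r) = graph_ball E v r \<union> \<Union>{e \<in> E. e \<inter> graph_ball E v r \<noteq> {}}"

text \<open>
  Every vertex has at most \<open>k\<close> edges with at most \<open>2 * k\<close> vertices on them.
\<close>
lemma card_graph_ball_le:
  assumes G: "regular_graph k V E" and v: "v \<in> V"
  shows "graph_ball E v r \<subseteq> V \<and> card (graph_ball E v r) \<le> (2 * k + 1) ^ r"
proof (induction r)
  case (Suc r)
  let ?B = "graph_ball E v r"
  have E: "\<And>e. e \<in> E \<Longrightarrow> e \<subseteq> V \<and> card e = 2" and V: "finite V"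
    and deg: "\<And>w. w \<in> V \<Longrightarrow> card {e \<in> E. w \<in> e} = k"
    using G by (auto simp: regular_graph_def)
  have sub: "graph_ball E v (Suc r) \<subseteq> V" using Suc E by auto
  have B: "finite ?B" using Suc V finite_subset by blast
  have near: "card (insert w (\<Union>{e \<in> E. w \<in> e})) \<le> 2 * k + 1" if "w \<in> ?B" for w
  proof -
    have "card (\<Union>{e \<in> E. w \<in> e}) \<le> (\<Sum>e\<in>{e \<in> E. w \<in> e}. card e)"
      by (rule card_Union_le_sum_card)
    also have "\<dots> = 2 * k" using E deg[of w] that Suc by (simp add: subset_iff)
    finally show ?thesis
      using card_insert_le_m1 by (metis Suc_eq_plus1 card_insert_le_m1 diff_Suc_1 le_SucI zero_less_Suc)
  qed
  have "graph_ball E v (Suc r) \<subseteq> (\<Union>w\<in>?B. insert w (\<Union>{e \<in> E. w \<in> e}))" by auto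
  moreover have "(\<Union>w\<in>?B. insert w (\<Union>{e \<in> E. w \<in> e})) \<subseteq> V" using Suc E by auto
  ultimately have "card (graph_ball E v (Suc r)) \<le> card (\<Union>w\<in>?B. insert w (\<Union>{e \<in> E. w \<in> e}))"
    using V finite_subset by (intro card_mono) blast+
  also have "\<dots> \<le> (\<Sum>w\<in>?B. card (insert w (\<Union>{e \<in> E. w \<in> e})))"
    by (rule card_UN_le[OF B])
  also have "\<dots> \<le> (\<Sum>w\<in>?B. 2 * k + 1)" by (rule sum_mono) (rule near)
  also have "\<dots> \<le> (2 * k + 1) ^ r * (2 * k + 1)"
    using Suc unfolding sum_constant of_nat_id by (intro mult_right_mono) auto
  finally show ?case using sub by (simp add: mult.commute)
qed (use v in simp)

text \<open>
  The minimum of \<open>n\<close> and the graph distance, which remains meaningful when \<open>u\<close> cannot be reached from \<open>v\<close>.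
\<close>
definition capped_dist :: "'v set set \<Rightarrow> nat \<Rightarrow> 'v \<Rightarrow> 'v \<Rightarrow> nat" where
  "capped_dist E n v u = (LEAST r. r = n \<or> u \<in> graph_ball E v r)"

lemma capped_dist_le: "capped_dist E n v u \<le> n"
  unfolding capped_dist_def by (rule Least_le) simp

lemma capped_dist_self: "capped_dist E n v v = 0"
  unfolding capped_dist_def by (rule Least_eq_0) simp

lemma capped_dist_attained: "capped_dist E n v u = n \<or> u \<in> graph_ball E v (capped_dist E n v u)"
  unfolding capped_dist_def by (rule LeastI[of _ n]) simp

lemma graph_ball_mono: "r \<le> s \<Longrightarrow> graph_ball E v r \<subseteq> graph_ball E v s"
  by (rule lift_Suc_mono_le[of "graph_ball E v"]) auto

lemma capped_dist_far: "u \<notin> graph_ball E v n \<Longrightarrow> capped_dist E n v u = n"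
  using capped_dist_attained graph_ball_mono[OF capped_dist_le] by fast

lemma capped_dist_step:
  assumes "{a, b} \<in> E"
  shows "capped_dist E n v b \<le> capped_dist E n v a + 1"
proof (cases "capped_dist E n v a = n")
  case True
  then show ?thesis using capped_dist_le[of E n v b] by simp
next
  case False
  then have "a \<in> graph_ball E v (capped_dist E n v a)" using capped_dist_attained by metis
  then have "b \<in> graph_ball E v (Suc (capped_dist E n v a))" using assms by auto
  then show ?thesis
    unfolding capped_dist_def[of E n v b] by (intro Least_le) simp
qed

lemma sum_over_far_pairs_ge:
  fixes F :: "'v \<times> 'v \<Rightarrow> real"
  assumes G: "regular_graph k V E" and large: "2 * (2 * k + 1) ^ n \<le> card V"
    and nonneg: "\<And>z. 0 \<le> F z" and c: "0 \<le> c"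
    and far: "\<And>u v. u \<in> V \<Longrightarrow> v \<in> V \<Longrightarrow> u \<notin> graph_ball E v n \<Longrightarrow> c \<le> F (u, v)"
  shows "c / 2 * (real (card V))\<^sup>2 \<le> (\<Sum>z\<in>V \<times> V. F z)"
proof -
  have V: "finite V" using G by (simp add: regular_graph_def)
  have "c / 2 * card V \<le> (\<Sum>u\<in>V. F (u, v))" if v: "v \<in> V" for v
  proof -
    have "card V \<le> 2 * card (V - graph_ball E v n)"
      using card_graph_ball_le[OF G v, of n] large V
      by (subst card_Diff_subset) (auto intro: finite_subset)
    then have "c / 2 * card V \<le> c / 2 * (2 * card (V - graph_ball E v n))"
      using c by (intro mult_left_mono) auto
    also have "\<dots> = (\<Sum>u\<in>V - graph_ball E v n. c)" by simp
    also have "\<dots> \<le> (\<Sum>u\<in>V - graph_ball E v n. F (u, v))"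
      using far v by (intro sum_mono) auto
    also have "\<dots> \<le> (\<Sum>u\<in>V. F (u, v))"
      using V nonneg by (intro sum_mono2) auto
    finally show ?thesis .
  qed
  then have "(\<Sum>v\<in>V. c / 2 * card V) \<le> (\<Sum>v\<in>V. \<Sum>u\<in>V. F (u, v))"
    by (rule sum_mono)
  also have "\<dots> = (\<Sum>u\<in>V. \<Sum>v\<in>V. F (u, v))" by (rule sum.swap)
  also have "\<dots> = (\<Sum>z\<in>V \<times> V. F z)" by (simp add: sum.cartesian_product)
  finally show ?thesis by (simp add: power2_eq_square mult_ac)
qed

section \<open>No expanders\<close>

theorem theorem9:
  fixes p :: real and k :: nat
    and V :: "nat \<Rightarrow> 'v set" and E :: "nat \<Rightarrow> 'v set set"
  assumes "1 < p"
    and "3 \<le> k"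
    and "\<And>j. regular_graph k (V j) (E j)"
    and "\<forall>N. \<exists>j. N < card (V j)"
  shows "\<not> expander_wrt V E (prob_measures_p p :: (real ^ 3) measure set) (wasserstein p)"
proof
  let ?P = "prob_measures_p p :: (real ^ 3) measure set"
  assume "expander_wrt V E ?P (wasserstein p)"
  then obtain C :: real where C: "0 < C" and poincare: "\<And>j x. (\<forall>u\<in>V j. x u \<in> ?P) \<Longrightarrow>
      1 / (real (card (V j)))\<^sup>2 * (\<Sum>(u, v)\<in>V j \<times> V j. (wasserstein p (x u) (x v))\<^sup>2)
      \<le> C / real (card (E j)) * (\<Sum>e\<in>E j. edge_sq_dist (wasserstein p) x e)"
    unfolding expander_wrt_def by (meson less_le_trans)
  \<comment> \<open>\<open>A\<close> bounds the length of an edge in units of \<open>s powr (1 / p)\<close>. Far pairs will have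
      length at least \<open>K\<close>, and \<open>K\<close> is chosen such that \<open>K\<^sup>2 / 2 > C * A\<^sup>2\<close>.\<close>
  define A where "A = (6 * 3 powr p) powr (1 / p)"
  define K where "K = 2 * C * A\<^sup>2 + 1"
  have K: "1 \<le> K" using C by (simp add: K_def)
  obtain n :: nat where n: "K powr p < n" using reals_Archimedean2 by blast
  obtain j where j: "2 * (2 * k + 1) ^ n < card (V j)" using assms(4) by blast
  have G: "regular_graph k (V j) (E j)" by (rule assms(3))
  have V: "finite (V j)" "V j \<noteq> {}" and edges: "\<forall>e\<in>E j. e \<subseteq> V j \<and> card e = 2"
    and deg: "\<And>v. v \<in> V j \<Longrightarrow> card {e \<in> E j. v \<in> e} = k"
    using G by (auto simp: regular_graph_def)
  have covered: "\<forall>u\<in>V j. \<exists>e\<in>E j. u \<in> e"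
  proof
    fix u assume "u \<in> V j"
    then have "{e \<in> E j. u \<in> e} \<noteq> {}" using deg[of u] assms(2) by force
    then show "\<exists>e\<in>E j. u \<in> e" by blast
  qed
  obtain \<mu> :: "'v \<Rightarrow> (real ^ 3) measure" and s :: real where s: "0 < s"
    and \<mu>: "\<And>u. \<mu> u \<in> ?P"
    and short: "\<And>a b. {a, b} \<in> E j \<Longrightarrow> wasserstein p (\<mu> a) (\<mu> b) \<le> (6 * 3 powr p * s) powr (1 / p)"
    and long: "\<forall>D. D ` V j \<subseteq> {0..real n} \<longrightarrow> edge_lipschitz (E j) D \<longrightarrow> (\<forall>u\<in>V j. \<forall>v\<in>V j. D v \<le> D u \<longrightarrow>
      (s * (D u - D v)) powr (1 / p) \<le> wasserstein p (\<mu> u) (\<mu> v))"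
    by (rule graph_into_wasserstein[OF assms(1) V(1) edges covered, where H = "real n"]) blast
  define t where "t = s powr (1 / p)"
  have t: "0 < t" using s by (simp add: t_def)
  have nonneg: "0 \<le> wasserstein p (\<mu> a) (\<mu> b)" for a b
    unfolding wasserstein_def using couplings_nonempty[OF \<mu> \<mu>]
    by (intro cINF_greatest) auto
  have edge: "edge_sq_dist (wasserstein p) \<mu> e \<le> (A * t)\<^sup>2" if eE: "e \<in> E j" for e
  proof -
    have "card e = 2" using edges eE by blast
    then obtain a b where e: "e = {a, b}" by (auto simp: card_2_iff)
    then have "wasserstein p (\<mu> a) (\<mu> b) \<le> A * t"
      using short[of a b] eE s by (simp add: A_def t_def powr_mult)
    then show ?thesis
      unfolding e edge_sq_dist_eq[of "wasserstein p", OF wasserstein_commute]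
      using nonneg by (intro power_mono)
  qed
  have "C / card (E j) * (\<Sum>e\<in>E j. edge_sq_dist (wasserstein p) \<mu> e)
      \<le> C / card (E j) * (\<Sum>e\<in>E j. (A * t)\<^sup>2)"
    using C edge by (intro mult_left_mono sum_mono) auto
  also have "\<dots> \<le> C * (A * t)\<^sup>2" using C by simp
  finally have upper: "C / card (E j) * (\<Sum>e\<in>E j. edge_sq_dist (wasserstein p) \<mu> e) \<le> C * (A * t)\<^sup>2" .
  have far: "(K * t)\<^sup>2 \<le> (wasserstein p (\<mu> u) (\<mu> v))\<^sup>2"
    if uv: "u \<in> V j" "v \<in> V j" "u \<notin> graph_ball (E j) v n" for u v
  proof -
    let ?D = "\<lambda>a. real (capped_dist (E j) n v a)"
    have "\<bar>?D a - ?D b\<bar> \<le> 1" if "{a, b} \<in> E j" for a b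
      using capped_dist_step[of a b "E j" n v] capped_dist_step[of b a "E j" n v] that
      by (simp add: insert_commute)
    then have "edge_lipschitz (E j) ?D" by (simp add: edge_lipschitz_def)
    moreover have "?D ` V j \<subseteq> {0..real n}" using capped_dist_le[of "E j" n v] by auto
    ultimately have "(s * (?D u - ?D v)) powr (1 / p) \<le> wasserstein p (\<mu> u) (\<mu> v)"
      using uv by (intro long[rule_format]) (auto simp: capped_dist_self)
    moreover have "?D u - ?D v = n"
      using capped_dist_far[OF uv(3)] by (simp add: capped_dist_self)
    moreover have "K \<le> n powr (1 / p)"
    proof -
      have "K = (K powr p) powr (1 / p)" using K assms(1) by (simp add: powr_powr)
      also have "\<dots> \<le> n powr (1 / p)" using n assms(1) by (intro powr_mono2) auto
      finally show ?thesis .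
    qed
    moreover have "(s * n) powr (1 / p) = n powr (1 / p) * t"
      using s by (simp add: t_def powr_mult mult.commute)
    ultimately have "K * t \<le> wasserstein p (\<mu> u) (\<mu> v)"
      using mult_right_mono[OF _ less_imp_le[OF t], of K "n powr (1 / p)"] by simp
    then show ?thesis using K t by (intro power_mono) auto
  qed
  have "(K * t)\<^sup>2 / 2 * (real (card (V j)))\<^sup>2
      \<le> (\<Sum>(u, v)\<in>V j \<times> V j. (wasserstein p (\<mu> u) (\<mu> v))\<^sup>2)"
    using j far by (intro sum_over_far_pairs_ge[OF G, of n]) (auto split: prod.splits)
  then have "(K * t)\<^sup>2 / 2
      \<le> 1 / (real (card (V j)))\<^sup>2 * (\<Sum>(u, v)\<in>V j \<times> V j. (wasserstein p (\<mu> u) (\<mu> v))\<^sup>2)"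
    using j by (simp add: field_simps)
  also have "\<dots> \<le> C * (A * t)\<^sup>2"
    using poincare[of j \<mu>] \<mu> upper by simp
  finally have "K\<^sup>2 * t\<^sup>2 \<le> (2 * C * A\<^sup>2) * t\<^sup>2"
    by (simp add: power_mult_distrib)
  then have "K\<^sup>2 \<le> K - 1" using t by (simp add: K_def)
  moreover have "K \<le> K\<^sup>2" using K self_le_power[of K 2] by simp
  ultimately show False by simp
qed

end
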